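(* Let $T$ be a plane tree with $n$ regions and root $\rho$. Then $$\mathbf M_T(\mathbb X)=\frac{1-t^{a(\rho)-1}}{1-q^n}\prod_{i\in\mathrm{Int}(T)}\frac{q^{r(i)}-t^{a(i)-1}}{1-q^{r(i)}},$$ where $\mathrm{Int}(T)$ is the set of internal nodes of $T$ other than the root, $a(i)$ is the arity (number of children) of the node $i$, and $r(i)$ is the number of regions of $T$ in the subtree rooted at $i$.
   Context: Plane trees: rooted ordered trees whose internal nodes have arity at least $2$; leaves are not counted as nodes. A region of $T$ is a part of the plane between two consecutive edges going down from the same internal node, so a node of arity $a$ has $a-1$ regions. For a (possibly empty) word $w$ over positive integers, its decreasing plane tree $\mathcal T(w)$ is a leaf if $w$ is empty; otherwise, if $m$ is the maximal letter of $w$, occurring $k$ times, write $w=w_0mw_1m\cdots mw_k$ with no $w_j$ containing $m$; then $\mathcal T(w)$ has a root of arity $k+1$ whose subtrees, from left to right, are $\mathcal T(w_0),\dots,\mathcal T(w_k)$. A packed word is a word with letter set $\{1,\dots,p\}$. For a packed word $u$ of length $N$ with evaluation $(i_1,\dots,i_p)=(|u|_1,\dots,|u|_p)$ the $(q,t)$-specialization at $\mathbb X=\frac1{1-q}\hat\times(1-t)$ of the $\mathbf{WQSym}$ basis element $\mathbf M_u$ is $\mathbf M_u(\mathbb X)=\frac{1-t^{i_p}}{1-q^N}\prod_{k=1}^{p-1}\frac{q^{i_1+\cdots+i_k}-t^{i_k}}{1-q^{i_1+\cdots+i_k}}$. The Loday–Ronco basis element of the free dendriform trialgebra is $\mathbf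 M_T=\sum_{\mathcal T(u)=T}\mathbf M_u$, so $\mathbf M_T(\mathbb X)=\sum_{u\ \mathrm{packed},\ \mathcal T(u)=T}\mathbf M_u(\mathbb X)$. *)

theory Defs
  imports Complex_Main
begin

datatype ptree = Leaf | Node (children: "ptree list")
where "children Leaf = []"

fun plane_tree :: "ptree \<Rightarrow> bool" where
  "plane_tree Leaf \<longleftrightarrow> True"
| "plane_tree (Node ts) \<longleftrightarrow> 2 \<le> length ts \<and> (\<forall>t\<in>set ts. plane_tree t)"

abbreviation root_arity :: "ptree \<Rightarrow> nat" where
  "root_arity T \<equiv> length (children T)"

fun num_regions :: "ptree \<Rightarrow> nat" where
  "num_regions Leaf = 0"
| "num_regions (Node ts) = (length ts - 1) + (\<Sum>t\<leftarrow>ts. num_regions t)"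

text \<open>A vertex is addressed by the list of child indices (counted from 0) leading to it from the
  root, so that distinct vertices carrying equal subtrees stay distinct. Addresses that lead outside
  the tree yield a leaf, hence are never addresses of internal nodes.\<close>

fun subtree_at :: "ptree \<Rightarrow> nat list \<Rightarrow> ptree" where
  "subtree_at T [] = T"
| "subtree_at T (i # p) =
    (if i < length (children T) then subtree_at (children T ! i) p else Leaf)"

definition internal_nodes :: "ptree \<Rightarrow> nat list set" where
  "internal_nodes T = {p. subtree_at T p \<noteq> Leaf}"

definition nonroot_internal_nodes :: "ptree \<Rightarrow> nat list set" where
  "nonroot_internal_nodes T = internal_nodes T - {[]}"

definition arity :: "ptree \<Rightarrow> nat list \<Rightarrow> nat" where
  "arity T p = root_arity (subtree_at T p)"

definition regions_below :: "ptree \<Rightarrow> nat list \<Rightarrow> nat" where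
  "regions_below T p = num_regions (subtree_at T p)"

text \<open>If \<open>m\<close> occurs \<open>k\<close> times in \<open>w = w\<^sub>0 m w\<^sub>1 m \<dots> m w\<^sub>k\<close>, then \<open>split_word m w\<close> is the list
  \<open>[w\<^sub>0, \<dots>, w\<^sub>k]\<close>, including empty factors.\<close>

fun split_word :: "'a \<Rightarrow> 'a list \<Rightarrow> 'a list list" where
  "split_word m [] = [[]]"
| "split_word m (x # xs) =
    (if x = m then [] # split_word m xs
     else (x # hd (split_word m xs)) # tl (split_word m xs))"

lemma split_word_neq_Nil [simp]: "split_word m w \<noteq> []"
  by (cases w) auto

lemma length_split_word: "length (split_word m w) = Suc (count_list w m)"
  by (induction w) auto

lemma split_word_length_le: "v \<in> set (split_word m w) \<Longrightarrow> length v \<le> length w"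
proof (induction w arbitrary: v)
  case (Cons x xs)
  have "hd (split_word m xs) \<in> set (split_word m xs)" by simp
  then show ?case
    using Cons by (fastforce split: if_splits dest: list.set_sel(2)[rotated])
qed simp

lemma split_word_length_less:
  "m \<in> set w \<Longrightarrow> v \<in> set (split_word m w) \<Longrightarrow> length v < length w"
proof (induction w arbitrary: v)
  case (Cons x xs)
  show ?case
  proof (cases "x = m")
    case True
    then show ?thesis using Cons.prems split_word_length_le[of v m xs] by auto
  next
    case False
    have "hd (split_word m xs) \<in> set (split_word m xs)" by simp
    then show ?thesis
      using False Cons by (fastforce dest: list.set_sel(2)[rotated])
  qed
qed simp

function decreasing_tree :: "nat list \<Rightarrow> ptree" where
  "decreasing_tree w =
    (if w = [] then Leaf else Node (map decreasing_tree (split_word (Max (set w)) w)))"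
  by pat_completeness auto
termination
  by (relation "measure length") (auto intro!: split_word_length_less Max_in)

declare decreasing_tree.simps [simp del]

definition packed :: "nat list \<Rightarrow> bool" where
  "packed u \<longleftrightarrow> (\<exists>p. set u = {1..p})"

text \<open>The value of the basis element \<open>\<^bold>M\<^sub>u\<close> at \<open>1/(1-q) \<times> (1-t)\<close>, for a nonempty packed word \<open>u\<close>;
  for such a word \<open>card (set u)\<close> is its maximal letter.\<close>

definition M_word :: "'a::field \<Rightarrow> 'a \<Rightarrow> nat list \<Rightarrow> 'a" where
  "M_word q t u =
    (let p = card (set u);
         e = count_list u;
         s = (\<lambda>k. \<Sum>j=1..k. e j)
     in (1 - t ^ e p) / (1 - q ^ length u) *
        (\<Prod>k=1..<p. (q ^ s k - t ^ e k) / (1 - q ^ s k)))"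

definition M_tree :: "'a::field \<Rightarrow> 'a \<Rightarrow> ptree \<Rightarrow> 'a" where
  "M_tree q t T = (\<Sum>u | packed u \<and> decreasing_tree u = T. M_word q t u)"

text \<open>The sum in \<open>M_tree\<close> is over a finite set, so it is a genuine sum and not zero by convention.\<close>

lemma sum_list_length_split_word:
  "(\<Sum>v\<leftarrow>split_word m w. length v) + count_list w m = length w"
proof (induction w)
  case (Cons x xs)
  obtain v vs where "split_word m xs = v # vs"
    using split_word_neq_Nil by (meson neq_Nil_conv)
  then show ?case using Cons by auto
qed simp

lemma num_regions_decreasing_tree: "num_regions (decreasing_tree w) = length w"
proof (induction w rule: decreasing_tree.induct)
  case (1 w)
  show ?case
  proof (cases "w = []")
    case True
    then show ?thesis by (simp add: decreasing_tree.simps)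
  next
    case False
    let ?ws = "split_word (Max (set w)) w"
    have "sum_list (map (num_regions \<circ> decreasing_tree) ?ws) = sum_list (map length ?ws)"
      using 1 False by (intro arg_cong[where f = sum_list] map_cong) auto
    then have "num_regions (decreasing_tree w) = count_list w (Max (set w)) + sum_list (map length ?ws)"
      using False by (subst decreasing_tree.simps) (simp add: length_split_word o_def)
    then show ?thesis
      using sum_list_length_split_word[of "Max (set w)" w] by simp
  qed
qed

lemma finite_packed_decreasing_tree: "finite {u. packed u \<and> decreasing_tree u = T}"
proof (rule finite_subset)
  show "{u. packed u \<and> decreasing_tree u = T} \<subseteq>
    {u. set u \<subseteq> {1..num_regions T} \<and> length u = num_regions T}"
  proof safe
    fix u x assume u: "packed u" and x: "x \<in> set u"
    obtain p where p: "set u = {1..p}" using u by (auto simp: packed_def)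
    then have "p \<le> length u" using card_length[of u] by simp
    with p x show "x \<in> {1..num_regions (decreasing_tree u)}"
      by (auto simp: num_regions_decreasing_tree)
  qed (simp add: num_regions_decreasing_tree)
qed (simp add: finite_lists_length_eq)

end

theory Submission imports Defs begin

text \<open>The sum is computed more generally for forests: a forest is labeled by a list of words whose
  concatenation is packed, and the weight is the product over all letters \<open>k\<close> of
  \<open>(q ^ s\<^sub>k - t ^ e\<^sub>k) / (1 - q ^ s\<^sub>k)\<close>. The nodes labeled by the maximal letter form a nonempty set \<open>S\<close> of
  roots, and deleting them leaves a labeling of a smaller forest. If \<open>x\<^sub>i = q ^ r(i)\<close>,
  \<open>A\<^sub>i = t ^ (a(i) - 1)\<close> and \<open>c\<^sub>i = (x\<^sub>i - A\<^sub>i) / (1 - x\<^sub>i)\<close>, then by induction the sum is the product of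
  the \<open>c\<^sub>i\<close> over all nodes, because with \<open>Q = \<Prod>x\<^sub>i\<close> over the roots, the sum of
  \<open>(Q - \<Prod>\<^bsub>i \<in> S\<^esub> A\<^sub>i) \<Prod>\<^bsub>i \<notin> S\<^esub> c\<^sub>i\<close> over all sets \<open>S\<close> of roots is
  \<open>Q \<Prod>(1 + c\<^sub>i) - \<Prod>(A\<^sub>i + c\<^sub>i) = 0\<close>. The tree itself is its root, alone on the top level, on top
  of the forest of its subtrees.\<close>

section \<open>Splitting words at a letter and joining them again\<close>

text \<open>Inverse of \<open>split_word m\<close> on nonempty lists of words without
  \<open>m\<close>. The value at \<open>[]\<close> is only a filler, since \<open>split_word\<close>
  never returns the empty list.\<close>

fun join_word :: "'a \<Rightarrow> 'a list list \<Rightarrow> 'a list" where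
  "join_word m [] = []"
| "join_word m [v] = v"
| "join_word m (v # w # vs) = v @ m # join_word m (w # vs)"

lemma join_word_split_word: "join_word m (split_word m w) = w"
proof (induction w)
  case (Cons x xs)
  obtain v vs where "split_word m xs = v # vs"
    using split_word_neq_Nil by (meson neq_Nil_conv)
  then show ?case using Cons by (cases vs) auto
qed simp

lemma split_word_notin: "m \<notin> set v \<Longrightarrow> split_word m v = [v]"
  by (induction v) auto

lemma split_word_append: "m \<notin> set v \<Longrightarrow> split_word m (v @ m # w) = v # split_word m w"
  by (induction v) auto

lemma split_word_join_word:
  "vs \<noteq> [] \<Longrightarrow> \<forall>v\<in>set vs. m \<notin> set v \<Longrightarrow> split_word m (join_word m vs) = vs"
  by (induction m vs rule: join_word.induct) (auto simp: split_word_notin split_word_append)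

text \<open>Multiplicities suffice for all later uses: they determine both the letter set of a
  stripped labeling and its level weights.\<close>

lemma count_list_concat_split_word:
  "count_list (concat (split_word m w)) x = (if x = m then 0 else count_list w x)"
proof (induction w)
  case (Cons y ys)
  obtain v vs where "split_word m ys = v # vs"
    using split_word_neq_Nil by (meson neq_Nil_conv)
  then show ?case using Cons by (auto split: if_splits)
qed simp

lemma count_list_concat_concat_split_word:
  "count_list (concat (concat (map (split_word m) ws))) x =
    (if x = m then 0 else count_list (concat ws) x)"
  by (induction ws) (auto simp: count_list_concat_split_word)

lemma set_concat_concat_split_word:
  "set (concat (concat (map (split_word m) ws))) = set (concat ws) - {m}"
proof (rule set_eqI)
  fix x
  show "x \<in> set (concat (concat (map (split_word m) ws))) \<longleftrightarrow> x \<in> set (concat ws) - {m}"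
    using count_list_concat_concat_split_word[of m ws x]
      count_list_0_iff[of "concat (concat (map (split_word m) ws))" x]
      count_list_0_iff[of "concat ws" x]
    by (auto split: if_splits simp del: set_concat)
qed

text \<open>A word cut into \<open>length vs\<close> factors contained \<open>length vs - 1\<close>
  separators. For the maximal letter this turns its multiplicity into a sum of arities minus
  one.\<close>

lemma sum_list_length_split_words:
  "(\<Sum>vs\<leftarrow>map (split_word m) ws. length vs - 1) = count_list (concat ws) m"
  by (induction ws) (auto simp: length_split_word)

section \<open>Keeping or deleting the root of a tree\<close>

text \<open>The choice whether the root belongs to the set \<open>S\<close> of nodes with the
  maximal letter: it stays, or it gives way to its children. A leaf offers no choice. In a plane
  tree, arity at least 2 lets the length of the list tell the two cases apart.\<close>

fun root_expansions :: "ptree \<Rightarrow> ptree list set" where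
  "root_expansions Leaf = {[Leaf]}"
| "root_expansions (Node ts) = {[Node ts], ts}"

lemma finite_root_expansions: "finite (root_expansions t)"
  by (cases t) auto

lemma singleton_in_root_expansions: "[t] \<in> root_expansions t"
  by (cases t) auto

lemma root_expansions_neq_Nil: "plane_tree t \<Longrightarrow> ts \<in> root_expansions t \<Longrightarrow> ts \<noteq> []"
  by (cases t) auto

lemma root_expansions_length_1:
  "plane_tree t \<Longrightarrow> ts \<in> root_expansions t \<Longrightarrow> length ts \<le> 1 \<Longrightarrow> ts = [t]"
  by (cases t) auto

lemma decreasing_tree_Nil [simp]: "decreasing_tree [] = Leaf"
  by (simp add: decreasing_tree.simps)

lemma decreasing_tree_split_word:
  assumes "m \<in> set w" "\<forall>x\<in>set w. x \<le> m"
  shows "decreasing_tree w = Node (map decreasing_tree (split_word m w))"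
proof -
  have "Max (set w) = m" using assms by (intro Max_eqI) auto
  then show ?thesis using assms by (subst decreasing_tree.simps) auto
qed

text \<open>Here \<open>m\<close> is meant as the maximal letter of a whole forest, which a single
  word may lack; the split is then trivial and the root stays.\<close>

lemma decreasing_tree_split_word_in_root_expansions:
  assumes "\<forall>x\<in>set w. x \<le> m"
  shows "map decreasing_tree (split_word m w) \<in> root_expansions (decreasing_tree w)"
proof (cases "m \<in> set w")
  case True
  then show ?thesis using assms by (simp add: decreasing_tree_split_word)
next
  case False
  then show ?thesis by (simp add: split_word_notin singleton_in_root_expansions)
qed

lemma set_join_word:
  "set (join_word m vs) = set (concat vs) \<union> (if length vs \<ge> 2 then {m} else {})"
  by (induction m vs rule: join_word.induct) auto

text \<open>Joining at least two words inserts \<open>m\<close>, which is then the maximum and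
  labels the root. A single word is left as it is, matching a root that stays.\<close>

lemma decreasing_tree_join_word:
  assumes "plane_tree t" "map decreasing_tree vs \<in> root_expansions t"
    and less: "\<forall>v\<in>set vs. \<forall>x\<in>set v. x < m"
  shows "decreasing_tree (join_word m vs) = t"
proof (cases "length vs \<le> 1")
  case True
  then have "map decreasing_tree vs = [t]"
    using root_expansions_length_1[OF assms(1,2)] by simp
  then show ?thesis by (auto simp: map_eq_Cons_conv)
next
  case False
  then obtain ts where t: "t = Node ts" and ts: "map decreasing_tree vs = ts"
    using assms(2) by (cases t) auto
  have "split_word m (join_word m vs) = vs"
    using False less by (intro split_word_join_word) auto
  moreover have "m \<in> set (join_word m vs)" "\<forall>x\<in>set (join_word m vs). x \<le> m"
    using False less by (auto simp: set_join_word less_imp_le)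
  ultimately show ?thesis using t ts decreasing_tree_split_word by metis
qed

section \<open>Packed labelings of forests and deletion of the maximal letter\<close>

lemma map_eq_concat_conv:
  "map f ws = concat tss \<Longrightarrow> \<exists>wss. concat wss = ws \<and> map (map f) wss = tss"
proof (induction tss arbitrary: ws)
  case (Cons ts tss)
  then obtain us vs where "ws = us @ vs" "map f us = ts" "map f vs = concat tss"
    by (auto simp: map_eq_append_conv)
  moreover from Cons.IH[OF this(3)] obtain wss where "concat wss = vs" "map (map f) wss = tss"
    by auto
  ultimately have "concat (us # wss) = ws \<and> map (map f) (us # wss) = ts # tss" by auto
  then show ?case by (rule exI)
qed simp

text \<open>The images under \<open>map (map f)\<close> still show the block lengths, and these fix
  how the common concatenation is cut.\<close>

lemma concat_map_inject:
  assumes "concat xss = concat yss" "map (map f) xss = map (map f) yss"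
  shows "xss = yss"
proof -
  have "length x = length y" if "(x, y) \<in> set (zip xss yss)" for x y
    using that assms(2) by (metis (no_types, lifting) in_set_zip length_map nth_map fst_conv snd_conv)
  moreover have "length xss = length yss" using assms(2) by (rule map_eq_imp_length_eq)
  ultimately show ?thesis using assms(1) by (intro concat_injective) auto
qed

text \<open>Packed labelings of the internal nodes of a forest, strictly decreasing along each branch;
  different trees of the forest may share letters.\<close>

definition packed_forest_words :: "ptree list \<Rightarrow> nat list list set" where
  "packed_forest_words ts = {ws. map decreasing_tree ws = ts \<and> packed (concat ws)}"

abbreviation top_letter :: "nat list list \<Rightarrow> nat" where
  "top_letter ws \<equiv> card (set (concat ws))"

lemma set_concat_packed: "packed (concat ws) \<Longrightarrow> set (concat ws) = {1..top_letter ws}"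
  by (metis packed_def card_atLeastAtMost diff_Suc_1)

lemma concat_neq_Nil_if_packed_forest_words:
  assumes "ws \<in> packed_forest_words ts" "\<not> set ts \<subseteq> {Leaf}"
  shows "concat ws \<noteq> []"
  using assms by (fastforce simp: packed_forest_words_def)

text \<open>One list per tree keeps the block boundaries that concatenation would lose. The
  expansion into singletons corresponds to the empty set \<open>S\<close>.\<close>

definition forest_expansions :: "ptree list \<Rightarrow> ptree list list set" where
  "forest_expansions ts = listset (map root_expansions ts)"

lemma in_listset_map_iff: "xs \<in> listset (map F ts) \<longleftrightarrow> list_all2 (\<lambda>x t. x \<in> F t) xs ts"
  by (induction ts arbitrary: xs) (auto simp: set_Cons_def list_all2_Cons2)

lemma listset_Cons_image: "listset (A # As) = (\<lambda>(x, xs). x # xs) ` (A \<times> listset As)"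
  by (auto simp: set_Cons_def)

lemma in_forest_expansions_iff:
  "tss \<in> forest_expansions ts \<longleftrightarrow> list_all2 (\<lambda>us t. us \<in> root_expansions t) tss ts"
  by (simp add: forest_expansions_def in_listset_map_iff)

lemma finite_forest_expansions: "finite (forest_expansions ts)"
  unfolding forest_expansions_def
  by (induction ts) (auto simp: listset_Cons_image finite_root_expansions simp del: listset.simps(2))

lemma trivial_forest_expansion: "map (\<lambda>t. [t]) ts \<in> forest_expansions ts"
  by (auto simp: in_forest_expansions_iff list_all2_conv_all_nth singleton_in_root_expansions)

text \<open>The first component records which roots carried the maximal letter, the second labels
  the remaining forest. Keeping the first makes the map invertible.\<close>

definition strip_top :: "nat list list \<Rightarrow> ptree list list \<times> nat list list" where
  "strip_top ws = (let wss = map (split_word (top_letter ws)) ws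
    in (map (map decreasing_tree) wss, concat wss))"

lemma top_letter_strip_top:
  assumes "packed (concat ws)"
  shows "top_letter (snd (strip_top ws)) = top_letter ws - 1"
    and "packed (concat (snd (strip_top ws)))"
proof -
  have *: "set (concat (snd (strip_top ws))) = {1..top_letter ws - 1}"
    unfolding strip_top_def Let_def snd_conv set_concat_concat_split_word
    by (subst set_concat_packed[OF assms]) auto
  show "top_letter (snd (strip_top ws)) = top_letter ws - 1" unfolding * by simp
  show "packed (concat (snd (strip_top ws)))" unfolding packed_def using * by blast
qed

lemma inj_on_strip_top:
  assumes "\<not> set ts \<subseteq> {Leaf}"
  shows "inj_on strip_top (packed_forest_words ts)"
proof (rule inj_onI)
  fix vs ws
  assume vs: "vs \<in> packed_forest_words ts" and ws: "ws \<in> packed_forest_words ts"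
    and eq: "strip_top vs = strip_top ws"
  \<comment> \<open>Top letters are compared through their predecessors, and truncated subtraction
    would confuse 0 with 1.\<close>
  have pos: "top_letter us > 0" if "us \<in> packed_forest_words ts" for us
    using concat_neq_Nil_if_packed_forest_words[OF that assms]
    by (metis card_gt_0_iff List.finite_set set_empty)
  have "top_letter vs - 1 = top_letter ws - 1"
    using eq vs ws by (metis (mono_tags) packed_forest_words_def mem_Collect_eq top_letter_strip_top(1))
  then have top: "top_letter vs = top_letter ws" using pos[OF vs] pos[OF ws] by simp
  have "map (split_word (top_letter vs)) vs = map (split_word (top_letter ws)) ws"
    using eq by (intro concat_map_inject[where f = decreasing_tree]) (simp_all add: strip_top_def Let_def)
  then have "map (join_word (top_letter ws)) (map (split_word (top_letter ws)) vs) =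
      map (join_word (top_letter ws)) (map (split_word (top_letter ws)) ws)"
    using top by simp
  then show "vs = ws" by (simp add: join_word_split_word o_def)
qed

lemma strip_top_in:
  assumes ne: "\<not> set ts \<subseteq> {Leaf}" and ws: "ws \<in> packed_forest_words ts"
  shows "strip_top ws \<in> (SIGMA tss:forest_expansions ts - {map (\<lambda>t. [t]) ts}. packed_forest_words (concat tss))"
proof -
  let ?p = "top_letter ws"
  have ts: "ts = map decreasing_tree ws" and packed: "packed (concat ws)"
    using ws by (auto simp: packed_forest_words_def)
  have "concat ws \<noteq> []"
    using ws ne by (rule concat_neq_Nil_if_packed_forest_words)
  then have "?p \<in> set (concat ws)"
    using set_concat_packed[OF packed] by (metis One_nat_def atLeastAtMost_iff card_gt_0_iff le_refl List.finite_set set_empty Suc_leI)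
  then obtain w where w: "w \<in> set ws" "?p \<in> set w" by auto
  have "\<forall>w\<in>set ws. \<forall>x\<in>set w. x \<le> ?p"
    using set_concat_packed[OF packed] by auto
  then have 1: "fst (strip_top ws) \<in> forest_expansions ts"
    by (auto simp: in_forest_expansions_iff strip_top_def ts list_all2_conv_all_nth
        intro!: decreasing_tree_split_word_in_root_expansions)
  \<comment> \<open>The word \<open>w\<close> contains the top letter, so it splits into at least
    two factors and its root is deleted.\<close>
  have 2: "fst (strip_top ws) \<noteq> map (\<lambda>t. [t]) ts"
  proof
    assume "fst (strip_top ws) = map (\<lambda>t. [t]) ts"
    then have "\<forall>w\<in>set ws. map decreasing_tree (split_word ?p w) = [decreasing_tree w]"
      by (simp add: strip_top_def ts)
    then have "length (split_word ?p w) = 1" using w by (metis length_map One_nat_def length_Cons list.size(3))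
    then show False using w by (simp add: length_split_word count_list_0_iff)
  qed
  have 3: "snd (strip_top ws) \<in> packed_forest_words (concat (fst (strip_top ws)))"
    using top_letter_strip_top(2)[OF packed]
    by (simp add: packed_forest_words_def strip_top_def Let_def map_concat)
  have "(fst (strip_top ws), snd (strip_top ws)) \<in>
      (SIGMA tss:forest_expansions ts - {map (\<lambda>t. [t]) ts}. packed_forest_words (concat tss))"
    using 1 2 3 by (intro SigmaI DiffI) (simp_all del: prod.collapse)
  then show ?thesis by (simp only: prod.collapse)
qed

text \<open>The preimage is built by joining the words of each block with the first letter not yet
  in use.\<close>

lemma strip_top_surj:
  assumes plane: "\<forall>t\<in>set ts. plane_tree t"
    and tss: "tss \<in> forest_expansions ts" "tss \<noteq> map (\<lambda>t. [t]) ts"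
    and us: "us \<in> packed_forest_words (concat tss)"
  shows "\<exists>ws\<in>packed_forest_words ts. strip_top ws = (tss, us)"
proof -
  define m where "m = Suc (top_letter us)"
  obtain wss where wss: "concat wss = us" "map (map decreasing_tree) wss = tss"
    using us map_eq_concat_conv by (fastforce simp: packed_forest_words_def)
  define ws where "ws = map (join_word m) wss"
  have packed: "packed (concat us)" using us by (simp add: packed_forest_words_def)
  have set_us: "set (concat us) = {1..<m}"
    using set_concat_packed[OF packed] by (simp only: m_def atLeastLessThanSuc_atLeastAtMost)
  have less: "x < m" if "vs \<in> set wss" "v \<in> set vs" "x \<in> set v" for vs v x
    using set_us that wss(1) by auto
  have len: "length wss = length ts" "length tss = length ts"
    using tss wss(2) by (auto simp: in_forest_expansions_iff dest: list_all2_lengthD)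
  have expn: "map decreasing_tree (wss ! i) \<in> root_expansions (ts ! i)" if "i < length ts" for i
    using tss(1) that len wss(2) by (auto simp: in_forest_expansions_iff list_all2_conv_all_nth)
  have "decreasing_tree (ws ! i) = ts ! i" if "i < length ts" for i
  proof -
    have "wss ! i \<in> set wss" using that len by simp
    then have "decreasing_tree (join_word m (wss ! i)) = ts ! i"
      using that less plane expn by (intro decreasing_tree_join_word) (simp, blast+)
    then show ?thesis using that len by (simp add: ws_def)
  qed
  then have dt: "map decreasing_tree ws = ts"
    by (intro nth_equalityI) (auto simp: ws_def len)
  have split: "split_word m (join_word m vs) = vs" if vs: "vs \<in> set wss" for vs
  proof (rule split_word_join_word)
    obtain i where "i < length ts" "vs = wss ! i" using vs len by (metis in_set_conv_nth)
    then show "vs \<noteq> []" using root_expansions_neq_Nil[OF _ expn] plane by fastforce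
    show "\<forall>v\<in>set vs. m \<notin> set v" using less vs by blast
  qed
  then have splits: "map (split_word m) ws = wss"
    by (simp add: ws_def o_def map_idI)
  \<comment> \<open>Nontriviality of the expansion enters here: some block has two words, so the
    joined labeling really contains \<open>m\<close> and has top letter \<open>m\<close>.\<close>
  have "\<exists>vs\<in>set wss. length vs \<ge> 2"
  proof (rule ccontr)
    assume "\<not> ?thesis"
    then have "length (wss ! i) \<le> 1" if "i < length ts" for i
      using that len by (metis nth_mem not_less_eq_eq numeral_2_eq_2 One_nat_def)
    then have "map decreasing_tree (wss ! i) = [ts ! i]" if "i < length ts" for i
      using that expn plane by (intro root_expansions_length_1) auto
    then have "tss = map (\<lambda>t. [t]) ts"
      using len wss(2) by (intro nth_equalityI) auto
    then show False using tss(2) by simp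
  qed
  then have "m \<in> set (concat ws)" by (auto simp: ws_def set_join_word)
  moreover have "set (concat ws) - {m} = {1..<m}"
    using set_concat_concat_split_word[of m ws] set_us wss(1) splits by simp
  moreover have "{1..m} = insert m {1..<m}" by (auto simp: m_def)
  ultimately have set_ws: "set (concat ws) = {1..m}" by (metis insert_Diff)
  then have "ws \<in> packed_forest_words ts"
    using dt unfolding packed_forest_words_def packed_def by blast
  moreover have "strip_top ws = (tss, us)"
    unfolding strip_top_def set_ws using wss splits by simp
  ultimately show ?thesis by blast
qed

lemma bij_betw_strip_top:
  assumes "\<forall>t\<in>set ts. plane_tree t" "\<not> set ts \<subseteq> {Leaf}"
  shows "bij_betw strip_top (packed_forest_words ts)
    (SIGMA tss:forest_expansions ts - {map (\<lambda>t. [t]) ts}. packed_forest_words (concat tss))"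
  unfolding bij_betw_def
proof (intro conjI equalityI subsetI)
  show "inj_on strip_top (packed_forest_words ts)" by (rule inj_on_strip_top[OF assms(2)])
next
  fix x assume "x \<in> strip_top ` packed_forest_words ts"
  then show "x \<in> (SIGMA tss:forest_expansions ts - {map (\<lambda>t. [t]) ts}. packed_forest_words (concat tss))"
    using strip_top_in[OF assms(2)] by blast
next
  fix x assume "x \<in> (SIGMA tss:forest_expansions ts - {map (\<lambda>t. [t]) ts}. packed_forest_words (concat tss))"
  then show "x \<in> strip_top ` packed_forest_words ts"
    using strip_top_surj[OF assms(1)] by (fastforce simp: image_iff)
qed

section \<open>Tree weights and the sum over expansions\<close>

lemma sum_listset_prod_list:
  fixes f :: "'b \<Rightarrow> 'c::comm_semiring_1"
  assumes "\<And>t. finite (F t)"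
  shows "(\<Sum>xs\<in>listset (map F ts). \<Prod>x\<leftarrow>xs. f x) = (\<Prod>t\<leftarrow>ts. \<Sum>x\<in>F t. f x)"
proof (induction ts)
  case (Cons t ts)
  have "(\<Sum>xs\<in>listset (map F (t # ts)). \<Prod>x\<leftarrow>xs. f x) =
      (\<Sum>(x, xs)\<in>F t \<times> listset (map F ts). f x * (\<Prod>x\<leftarrow>xs. f x))"
    unfolding list.map listset_Cons_image
    by (subst sum.reindex) (auto simp: inj_on_def intro!: sum.cong)
  also have "\<dots> = (\<Sum>x\<in>F t. f x) * (\<Sum>xs\<in>listset (map F ts). \<Prod>x\<leftarrow>xs. f x)"
    by (simp add: sum_product sum.cartesian_product)
  finally show ?case using Cons by simp
qed simp

lemma internal_nodes_Leaf: "internal_nodes Leaf = {}"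
proof -
  have "subtree_at Leaf p = Leaf" for p by (cases p) auto
  then show ?thesis by (simp add: internal_nodes_def)
qed

lemma nonroot_internal_nodes_Node:
  "nonroot_internal_nodes (Node ts) = (\<Union>i<length ts. (#) i ` internal_nodes (ts ! i))"
proof (rule set_eqI)
  fix p
  show "p \<in> nonroot_internal_nodes (Node ts) \<longleftrightarrow> p \<in> (\<Union>i<length ts. (#) i ` internal_nodes (ts ! i))"
    by (cases p) (auto simp: nonroot_internal_nodes_def internal_nodes_def)
qed

lemma internal_nodes_Node: "internal_nodes (Node ts) = insert [] (nonroot_internal_nodes (Node ts))"
  by (auto simp: nonroot_internal_nodes_def internal_nodes_def)

lemma finite_internal_nodes: "finite (internal_nodes T)"
proof (induction T)
  case (Node ts)
  then show ?case by (simp add: internal_nodes_Node nonroot_internal_nodes_Node)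
qed (simp add: internal_nodes_Leaf)

definition node_weight :: "'a::field \<Rightarrow> 'a \<Rightarrow> ptree \<Rightarrow> 'a" where
  "node_weight q t T = (q ^ num_regions T - t ^ (root_arity T - 1)) / (1 - q ^ num_regions T)"

text \<open>The root is included, because the forests considered lie below the root of the original
  tree, where each of their internal nodes contributes a factor.\<close>

definition tree_weight :: "'a::field \<Rightarrow> 'a \<Rightarrow> ptree \<Rightarrow> 'a" where
  "tree_weight q t T = (\<Prod>i\<in>internal_nodes T. node_weight q t (subtree_at T i))"

lemma tree_weight_Leaf: "tree_weight q t Leaf = 1"
  by (simp add: tree_weight_def internal_nodes_Leaf)

text \<open>Addresses that start with different child indices are disjoint, so the product factors
  over the children even if some of these are equal trees.\<close>

lemma prod_nonroot_internal_nodes: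
  "(\<Prod>i\<in>nonroot_internal_nodes (Node ts). node_weight q t (subtree_at (Node ts) i)) =
    (\<Prod>s\<leftarrow>ts. tree_weight q t s)"
proof -
  have "(\<Prod>i\<in>nonroot_internal_nodes (Node ts). node_weight q t (subtree_at (Node ts) i)) =
      (\<Prod>i<length ts. tree_weight q t (ts ! i))"
    unfolding nonroot_internal_nodes_Node tree_weight_def
    by (subst prod.UNION_disjoint) (auto simp: finite_internal_nodes prod.reindex)
  then show ?thesis by (simp add: prod.list_conv_set_nth atLeast0LessThan)
qed

lemma tree_weight_Node:
  "tree_weight q t (Node ts) = node_weight q t (Node ts) * (\<Prod>s\<leftarrow>ts. tree_weight q t s)"
proof -
  have "finite (nonroot_internal_nodes (Node ts))" "[] \<notin> nonroot_internal_nodes (Node ts)"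
    by (auto simp: nonroot_internal_nodes_def finite_internal_nodes)
  then show ?thesis
    unfolding tree_weight_def[of q t "Node ts"] internal_nodes_Node
    by (simp add: prod_nonroot_internal_nodes)
qed

lemma num_regions_pos: "plane_tree T \<Longrightarrow> T \<noteq> Leaf \<Longrightarrow> num_regions T \<ge> 1"
  by (cases T) auto

text \<open>For \<open>c = (x - A) / (1 - x)\<close> one has \<open>c + A = x (c + 1)\<close>; hence the sum over all choices
  of a set of roots, the empty set included, vanishes.\<close>

lemma sum_root_expansions:
  fixes q t :: "'a::field"
  assumes q: "\<And>k. k \<ge> 1 \<Longrightarrow> q ^ k \<noteq> 1" and T: "plane_tree T"
  shows "(\<Sum>us\<in>root_expansions T. t ^ (length us - 1) * (\<Prod>u\<leftarrow>us. tree_weight q t u)) =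
    q ^ num_regions T * (\<Sum>us\<in>root_expansions T. \<Prod>u\<leftarrow>us. tree_weight q t u)"
proof (cases T)
  case Leaf
  then show ?thesis by simp
next
  case (Node ts)
  let ?x = "q ^ num_regions T" and ?A = "t ^ (length ts - 1)" and ?w = "\<Prod>s\<leftarrow>ts. tree_weight q t s"
  have x: "1 - ?x \<noteq> 0" using q[OF num_regions_pos[OF T]] Node by simp
  \<comment> \<open>Arity at least 2 keeps the two expansions distinct, so the sum over the set
    really has two terms.\<close>
  have ne: "[Node ts] \<noteq> ts" using T Node by (auto dest: arg_cong[where f = length])
  define c where "c = node_weight q t T"
  have "c * (1 - ?x) = ?x - ?A" using x Node by (simp add: c_def node_weight_def)
  then have "c + ?A = ?x * (c + 1)" by (simp add: algebra_simps)
  then have "(c + ?A) * ?w = ?x * ((c + 1) * ?w)" by simp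
  then show ?thesis using Node ne by (simp add: tree_weight_Node c_def algebra_simps)
qed

text \<open>Over all expansions the sum is zero: both parts factor over the trees, and
  \<open>sum_root_expansions\<close> matches the factors up to powers of \<open>q\<close> with
  product \<open>Q\<close>. The right-hand side is minus the term of the trivial expansion.\<close>

lemma sum_forest_expansions:
  fixes q t :: "'a::field"
  assumes q: "\<And>k. k \<ge> 1 \<Longrightarrow> q ^ k \<noteq> 1" and ts: "\<forall>s\<in>set ts. plane_tree s"
  defines "Q \<equiv> q ^ (\<Sum>s\<leftarrow>ts. num_regions s)"
  shows "(\<Sum>tss\<in>forest_expansions ts - {map (\<lambda>s. [s]) ts}.
      (Q - t ^ (\<Sum>us\<leftarrow>tss. length us - 1)) * (\<Prod>u\<leftarrow>concat tss. tree_weight q t u)) =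
    (1 - Q) * (\<Prod>s\<leftarrow>ts. tree_weight q t s)"
proof -
  let ?w = "\<lambda>us. \<Prod>u\<leftarrow>us. tree_weight q t u"
  let ?f = "\<lambda>tss. (Q - t ^ (\<Sum>us\<leftarrow>tss. length us - 1)) * ?w (concat tss)"
  let ?triv = "map (\<lambda>s. [s]) ts"
  have w: "?w (concat tss) = (\<Prod>us\<leftarrow>tss. ?w us)" for tss
    by (induction tss) auto
  have tw: "t ^ (\<Sum>us\<leftarrow>tss. length us - 1) * ?w (concat tss) =
      (\<Prod>us\<leftarrow>tss. t ^ (length us - 1) * ?w us)" for tss
    by (induction tss) (auto simp: power_add mult_ac)
  have "(\<Sum>tss\<in>forest_expansions ts. t ^ (\<Sum>us\<leftarrow>tss. length us - 1) * ?w (concat tss)) =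
      (\<Prod>s\<leftarrow>ts. \<Sum>us\<in>root_expansions s. t ^ (length us - 1) * ?w us)"
    unfolding tw forest_expansions_def by (rule sum_listset_prod_list[OF finite_root_expansions])
  also have "\<dots> = (\<Prod>s\<leftarrow>ts. q ^ num_regions s * (\<Sum>us\<in>root_expansions s. ?w us))"
    using sum_root_expansions[OF q] ts by (intro arg_cong[where f = prod_list] map_cong) auto
  also have "\<dots> = Q * (\<Prod>s\<leftarrow>ts. \<Sum>us\<in>root_expansions s. ?w us)"
    unfolding Q_def by (induction ts) (auto simp: power_add mult_ac)
  also have "(\<Prod>s\<leftarrow>ts. \<Sum>us\<in>root_expansions s. ?w us) =
      (\<Sum>tss\<in>forest_expansions ts. ?w (concat tss))"
    unfolding w forest_expansions_def by (rule sum_listset_prod_list[OF finite_root_expansions, symmetric])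
  finally have "(\<Sum>tss\<in>forest_expansions ts. ?f tss) = 0"
    by (simp add: left_diff_distrib sum_subtractf sum_distrib_left)
  moreover have "?f ?triv = (Q - 1) * ?w ts"
  proof -
    have "(\<Sum>us\<leftarrow>?triv. length us - 1) = 0" by simp
    moreover have "concat ?triv = ts" by simp
    ultimately show ?thesis by (simp only: power_0)
  qed
  ultimately have "0 = (Q - 1) * ?w ts + (\<Sum>tss\<in>forest_expansions ts - {?triv}. ?f tss)"
    using sum.remove[OF finite_forest_expansions trivial_forest_expansion, of ?f ts] by (simp only:)
  then have "(\<Sum>tss\<in>forest_expansions ts - {?triv}. ?f tss) = - ((Q - 1) * ?w ts)"
    by (rule minus_unique[OF sym, symmetric])
  then show ?thesis by (simp only: mult_minus_left[symmetric] minus_diff_eq)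
qed

section \<open>Weights of packed labelings, letter by letter\<close>

definition level_weight :: "'a::field \<Rightarrow> 'a \<Rightarrow> nat list \<Rightarrow> nat \<Rightarrow> 'a" where
  "level_weight q t u k =
    (q ^ (\<Sum>j=1..k. count_list u j) - t ^ count_list u k) / (1 - q ^ (\<Sum>j=1..k. count_list u j))"

text \<open>For a nonempty packed word this differs from \<open>M_word\<close> only at the maximal
  letter, where the numerator has \<open>q ^ length u\<close> in place of 1.\<close>

definition word_weight :: "'a::field \<Rightarrow> 'a \<Rightarrow> nat list \<Rightarrow> 'a" where
  "word_weight q t u = (\<Prod>k=1..card (set u). level_weight q t u k)"

lemma count_list_top_letter:
  "count_list (concat ws) (top_letter ws) = (\<Sum>us\<leftarrow>fst (strip_top ws). length us - 1)"
  by (simp add: strip_top_def Let_def sum_list_length_split_words[symmetric] o_def)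

text \<open>The factor at \<open>k\<close> depends only on multiplicities of letters up to
  \<open>k\<close>, and these survive the deletion of a larger letter.\<close>

lemma prod_level_weight_strip_top:
  assumes "packed (concat ws)"
  shows "(\<Prod>k=1..<top_letter ws. level_weight q t (concat ws) k) =
    word_weight q t (concat (snd (strip_top ws)))"
proof -
  have count: "count_list (concat (snd (strip_top ws))) k = count_list (concat ws) k"
    if "k < top_letter ws" for k
    using that count_list_concat_concat_split_word[of "top_letter ws" ws k]
    by (simp add: strip_top_def Let_def)
  have "level_weight q t (concat (snd (strip_top ws))) k = level_weight q t (concat ws) k"
    if "k < top_letter ws" for k
  proof -
    have "(\<Sum>j=1..k. count_list (concat (snd (strip_top ws))) j) = (\<Sum>j=1..k. count_list (concat ws) j)"
      using that by (intro sum.cong count) auto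
    then show ?thesis unfolding level_weight_def count[OF that] by simp
  qed
  then show ?thesis
    unfolding word_weight_def top_letter_strip_top(1)[OF assms]
    by (intro prod.cong) auto
qed

lemma length_concat_packed_forest_words:
  assumes "ws \<in> packed_forest_words ts"
  shows "length (concat ws) = (\<Sum>s\<leftarrow>ts. num_regions s)"
  using assms by (auto simp: packed_forest_words_def length_concat num_regions_decreasing_tree o_def)

lemma word_weight_strip_top:
  fixes q t :: "'a::field"
  assumes ws: "ws \<in> packed_forest_words ts" and ne: "\<not> set ts \<subseteq> {Leaf}"
  defines "Q \<equiv> q ^ (\<Sum>s\<leftarrow>ts. num_regions s)"
  shows "word_weight q t (concat ws) =
    (Q - t ^ (\<Sum>us\<leftarrow>fst (strip_top ws). length us - 1)) / (1 - Q) *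
      word_weight q t (concat (snd (strip_top ws)))"
proof -
  let ?p = "top_letter ws"
  have packed: "packed (concat ws)" using ws by (simp add: packed_forest_words_def)
  have "?p > 0"
    using concat_neq_Nil_if_packed_forest_words[OF ws ne]
    by (metis card_gt_0_iff List.finite_set set_empty)
  then have "{1..?p} = insert ?p {1..<?p}" by auto
  then have "word_weight q t (concat ws) =
      level_weight q t (concat ws) ?p * (\<Prod>k=1..<?p. level_weight q t (concat ws) k)"
    unfolding word_weight_def by simp
  \<comment> \<open>At the top letter the partial sum of multiplicities is the total length, hence
    the number of regions.\<close>
  moreover have "(\<Sum>j=1..?p. count_list (concat ws) j) = (\<Sum>s\<leftarrow>ts. num_regions s)"
    using sum_count_set[of "concat ws" "{1..?p}"] set_concat_packed[OF packed]
      length_concat_packed_forest_words[OF ws] by simp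
  ultimately show ?thesis
    unfolding prod_level_weight_strip_top[OF packed]
    by (simp only: level_weight_def count_list_top_letter Q_def)
qed

lemma finite_packed_forest_words: "finite (packed_forest_words ts)"
proof (rule finite_subset)
  let ?N = "\<Sum>s\<leftarrow>ts. num_regions s"
  let ?L = "{w. set w \<subseteq> {1..?N} \<and> length w \<le> ?N}"
  show "packed_forest_words ts \<subseteq> {ws. set ws \<subseteq> ?L \<and> length ws = length ts}"
  proof
    fix ws assume ws: "ws \<in> packed_forest_words ts"
    have packed: "packed (concat ws)" using ws by (simp add: packed_forest_words_def)
    have "top_letter ws \<le> ?N"
      using card_length[of "concat ws"] length_concat_packed_forest_words[OF ws] by simp
    then have 1: "set w \<subseteq> {1..?N}" if "w \<in> set ws" for w
    proof -
      have "set w \<subseteq> set (concat ws)" using that by auto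
      also have "\<dots> = {1..top_letter ws}" by (rule set_concat_packed[OF packed])
      also have "\<dots> \<subseteq> {1..?N}" using \<open>top_letter ws \<le> ?N\<close> by (intro atLeastatMost_subset_iff[THEN iffD2]) auto
      finally show ?thesis .
    qed
    have 2: "length w \<le> ?N" if "w \<in> set ws" for w
      using member_le_sum_list[of "length w" "map length ws"] that
      by (simp flip: length_concat_packed_forest_words[OF ws] add: length_concat)
    have "length ws = length ts" using ws by (auto simp: packed_forest_words_def)
    with 1 2 show "ws \<in> {ws. set ws \<subseteq> ?L \<and> length ws = length ts}" by blast
  qed
  show "finite {ws. set ws \<subseteq> ?L \<and> length ws = length ts}"
    by (intro finite_lists_length_eq finite_lists_length_le) simp
qed

section \<open>Induction on the number of regions of a forest\<close>

lemma sum_strip_top: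
  assumes "\<forall>s\<in>set ts. plane_tree s" "\<not> set ts \<subseteq> {Leaf}"
  shows "(\<Sum>ws\<in>packed_forest_words ts. g (fst (strip_top ws)) (snd (strip_top ws))) =
    (\<Sum>tss\<in>forest_expansions ts - {map (\<lambda>s. [s]) ts}. \<Sum>us\<in>packed_forest_words (concat tss). g tss us)"
proof -
  have "(\<Sum>ws\<in>packed_forest_words ts. case strip_top ws of (tss, us) \<Rightarrow> g tss us) =
      (\<Sum>(tss, us)\<in>(SIGMA tss:forest_expansions ts - {map (\<lambda>s. [s]) ts}. packed_forest_words (concat tss)). g tss us)"
    by (rule sum.reindex_bij_betw[OF bij_betw_strip_top[OF assms]])
  also have "\<dots> = (\<Sum>tss\<in>forest_expansions ts - {map (\<lambda>s. [s]) ts}. \<Sum>us\<in>packed_forest_words (concat tss). g tss us)"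
    by (rule sum.Sigma[symmetric]) (auto simp: finite_forest_expansions finite_packed_forest_words)
  finally show ?thesis by (simp add: case_prod_beta)
qed

lemma forest_expansion_plane_tree:
  assumes "\<forall>s\<in>set ts. plane_tree s" "tss \<in> forest_expansions ts"
  shows "\<forall>s\<in>set (concat tss). plane_tree s"
proof -
  have "list_all2 (\<lambda>us t. us \<in> root_expansions t) tss ts"
    using assms(2) by (simp add: in_forest_expansions_iff)
  then show ?thesis using assms(1)
  proof induction
    case (Cons us tss t ts)
    then show ?case by (cases t) auto
  qed simp
qed

lemma num_regions_forest_expansion:
  assumes "\<forall>s\<in>set ts. plane_tree s" "tss \<in> forest_expansions ts"
  shows "(\<Sum>s\<leftarrow>concat tss. num_regions s) + (\<Sum>us\<leftarrow>tss. length us - 1) = (\<Sum>s\<leftarrow>ts. num_regions s)"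
proof -
  have "list_all2 (\<lambda>us t. us \<in> root_expansions t) tss ts"
    using assms(2) by (simp add: in_forest_expansions_iff)
  then show ?thesis
  proof induction
    case (Cons us tss t ts)
    then show ?case by (cases t) auto
  qed simp
qed

text \<open>Deleting a root of arity \<open>a\<close> loses \<open>a - 1\<close> regions, which is
  positive; only the trivial expansion deletes no root. This gives the descent for the
  induction.\<close>

lemma num_regions_nontrivial_forest_expansion:
  assumes "\<forall>s\<in>set ts. plane_tree s" "tss \<in> forest_expansions ts" "tss \<noteq> map (\<lambda>s. [s]) ts"
  shows "(\<Sum>s\<leftarrow>concat tss. num_regions s) < (\<Sum>s\<leftarrow>ts. num_regions s)"
proof (rule ccontr)
  assume ge: "\<not> ?thesis"
  have *: "\<forall>us\<in>set tss. length us \<le> 1"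
  proof -
    have "(\<Sum>us\<leftarrow>tss. length us - 1) = 0"
      using ge num_regions_forest_expansion[OF assms(1,2)] by linarith
    then show ?thesis by (simp add: sum_list_eq_0_iff)
  qed
  have "tss = map (\<lambda>s. [s]) ts"
  proof (rule nth_equalityI)
    have all: "list_all2 (\<lambda>us t. us \<in> root_expansions t) tss ts"
      using assms(2) by (simp add: in_forest_expansions_iff)
    then show len: "length tss = length (map (\<lambda>s. [s]) ts)" by (auto dest: list_all2_lengthD)
    fix i assume i: "i < length tss"
    have "tss ! i = [ts ! i]"
      using i len assms(1) * list_all2_nthD[OF all i] by (intro root_expansions_length_1) auto
    then show "tss ! i = map (\<lambda>s. [s]) ts ! i" using i len by simp
  qed
  then show False using assms(3) by simp
qed

lemma packed_forest_words_Leaf: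
  assumes "set ts \<subseteq> {Leaf}"
  shows "packed_forest_words ts = {map (\<lambda>_. []) ts}"
proof -
  have "decreasing_tree w = Leaf \<longleftrightarrow> w = []" for w
    by (subst decreasing_tree.simps) simp
  then have "map decreasing_tree ws = ts \<longleftrightarrow> ws = map (\<lambda>_. []) ts" for ws
    using assms
  proof (induction ts arbitrary: ws)
    case (Cons t ts)
    then show ?case by (cases ws) auto
  qed simp
  \<comment> \<open>The empty word is packed with \<open>p = 0\<close>, as \<open>{1..0}\<close> is
    empty.\<close>
  moreover have "packed (concat (map (\<lambda>_. []) ts))"
    by (auto simp: packed_def intro: exI[of _ 0])
  ultimately show ?thesis by (auto simp: packed_forest_words_def)
qed

text \<open>The induction must run over whole forests: trees may share letters and packedness
  concerns only the concatenation, so the sum does not split over the trees by itself.\<close>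

lemma sum_word_weight_packed_forest_words:
  fixes q t :: "'a::field"
  assumes q: "\<And>k. k \<ge> 1 \<Longrightarrow> q ^ k \<noteq> 1" and "\<forall>s\<in>set ts. plane_tree s"
  shows "(\<Sum>ws\<in>packed_forest_words ts. word_weight q t (concat ws)) = (\<Prod>s\<leftarrow>ts. tree_weight q t s)"
  using assms(2)
proof (induction "\<Sum>s\<leftarrow>ts. num_regions s" arbitrary: ts rule: less_induct)
  case less
  note plane = less.prems
  show ?case
  proof (cases "set ts \<subseteq> {Leaf}")
    case True
    then have "(\<Prod>s\<leftarrow>ts. tree_weight q t s) = 1"
      by (induction ts) (auto simp: tree_weight_Leaf)
    moreover have "concat (map (\<lambda>_. []) ts) = ([] :: nat list)" by simp
    ultimately show ?thesis
      by (simp add: packed_forest_words_Leaf[OF True] word_weight_def)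
  next
    case False
    define Q where "Q = q ^ (\<Sum>s\<leftarrow>ts. num_regions s)"
    let ?E = "forest_expansions ts - {map (\<lambda>s. [s]) ts}"
    let ?e = "\<lambda>tss. \<Sum>us\<leftarrow>tss. length us - 1"
    obtain s where s: "s \<in> set ts" "s \<noteq> Leaf" using False by auto
    then have "num_regions s \<ge> 1" using plane num_regions_pos by blast
    then have "(\<Sum>s\<leftarrow>ts. num_regions s) \<ge> 1"
      using member_le_sum_list[of "num_regions s" "map num_regions ts"] s(1) by auto
    then have Q: "1 - Q \<noteq> 0" using q by (simp add: Q_def)
    have "(\<Sum>ws\<in>packed_forest_words ts. word_weight q t (concat ws)) =
        (\<Sum>ws\<in>packed_forest_words ts. (Q - t ^ ?e (fst (strip_top ws))) / (1 - Q) *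
          word_weight q t (concat (snd (strip_top ws))))"
      unfolding Q_def using False by (intro sum.cong word_weight_strip_top) auto
    also have "\<dots> = (\<Sum>tss\<in>?E. \<Sum>us\<in>packed_forest_words (concat tss).
        (Q - t ^ ?e tss) / (1 - Q) * word_weight q t (concat us))"
      by (rule sum_strip_top[OF plane False])
    also have "\<dots> = (\<Sum>tss\<in>?E. (Q - t ^ ?e tss) / (1 - Q) * (\<Prod>u\<leftarrow>concat tss. tree_weight q t u))"
      unfolding sum_distrib_left[symmetric]
    proof (rule sum.cong[OF refl])
      fix tss assume tss: "tss \<in> ?E"
      then have "(\<Sum>us\<in>packed_forest_words (concat tss). word_weight q t (concat us)) =
          (\<Prod>u\<leftarrow>concat tss. tree_weight q t u)"
        using plane forest_expansion_plane_tree
        by (intro less.hyps num_regions_nontrivial_forest_expansion) blast+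
      then show "(Q - t ^ ?e tss) / (1 - Q) * (\<Sum>us\<in>packed_forest_words (concat tss). word_weight q t (concat us)) =
          (Q - t ^ ?e tss) / (1 - Q) * (\<Prod>u\<leftarrow>concat tss. tree_weight q t u)" by simp
    qed
    also have "\<dots> = (\<Sum>tss\<in>?E. (Q - t ^ ?e tss) * (\<Prod>u\<leftarrow>concat tss. tree_weight q t u)) / (1 - Q)"
      by (simp add: sum_divide_distrib)
    also have "\<dots> = (\<Prod>s\<leftarrow>ts. tree_weight q t s)"
      using sum_forest_expansions[OF q plane, of t] Q unfolding Q_def[symmetric] by simp
    finally show ?thesis .
  qed
qed

section \<open>Return to a single tree\<close>

lemma M_word_strip_top:
  assumes "packed u"
  shows "M_word q t u = (1 - t ^ (\<Sum>us\<leftarrow>fst (strip_top [u]). length us - 1)) / (1 - q ^ length u) *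
    word_weight q t (concat (snd (strip_top [u])))"
  using prod_level_weight_strip_top[of "[u]" q t] count_list_top_letter[of "[u]"] assms
  by (simp add: M_word_def Let_def level_weight_def)

theorem theorem8p1:
  fixes q t :: "'a::field" and T :: ptree and n :: nat
  assumes "\<And>k. k \<ge> 1 \<Longrightarrow> q ^ k \<noteq> 1"
    and "plane_tree T" and "T \<noteq> Leaf"
    and "num_regions T = n"
  shows "M_tree q t T =
    (1 - t ^ (arity T [] - 1)) / (1 - q ^ n) *
    (\<Prod>i\<in>nonroot_internal_nodes T.
      (q ^ regions_below T i - t ^ (arity T i - 1)) / (1 - q ^ regions_below T i))"
proof -
  obtain ts where T: "T = Node ts" using assms(3) by (cases T) auto
  have ts: "length ts \<ge> 2" "\<forall>s\<in>set ts. plane_tree s" using assms(2) T by auto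
  \<comment> \<open>In a one-tree forest the maximal letter must sit at the root. A single expansion
    remains, so the exceptional numerator of the top factor can be pulled out of the sum.\<close>
  have expansions: "forest_expansions [T] - {map (\<lambda>s. [s]) [T]} = {[ts]}"
    using ts(1) by (auto simp: forest_expansions_def T set_Cons_def dest: arg_cong[where f = length])
  let ?g = "\<lambda>tss us. (1 - t ^ (\<Sum>us\<leftarrow>tss. length us - 1)) / (1 - q ^ n) * word_weight q t (concat us)"
  have "packed_forest_words [T] = (\<lambda>u. [u]) ` {u. packed u \<and> decreasing_tree u = T}"
    by (auto simp: packed_forest_words_def)
  then have "(\<Sum>ws\<in>packed_forest_words [T]. ?g (fst (strip_top ws)) (snd (strip_top ws))) =
      (\<Sum>u | packed u \<and> decreasing_tree u = T. ?g (fst (strip_top [u])) (snd (strip_top [u])))"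
    by (simp add: sum.reindex inj_on_def)
  also have "\<dots> = M_tree q t T"
    unfolding M_tree_def using assms(4)
    by (intro sum.cong) (auto simp: M_word_strip_top num_regions_decreasing_tree)
  finally have "M_tree q t T = (\<Sum>us\<in>packed_forest_words (concat [ts]). ?g [ts] us)"
    using sum_strip_top[of "[T]" ?g] assms(2,3) unfolding expansions by simp
  also have "\<dots> = (1 - t ^ (length ts - 1)) / (1 - q ^ n) *
      (\<Sum>us\<in>packed_forest_words ts. word_weight q t (concat us))"
    by (simp add: sum_distrib_left)
  also have "\<dots> = (1 - t ^ (length ts - 1)) / (1 - q ^ n) * (\<Prod>s\<leftarrow>ts. tree_weight q t s)"
    using sum_word_weight_packed_forest_words[OF assms(1) ts(2)] by simp
  finally show ?thesis
    unfolding prod_nonroot_internal_nodes[symmetric]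
    by (simp add: T arity_def regions_below_def node_weight_def)
qed

end
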